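(* Let $\mathbf P=(P,\le,0)$ be a poset with least element $0$ and let $f$ be a bijective $\perp$-morphism of $\mathbf P$ such that $f^{-1}$ is a $\perp$-morphism of $\mathbf P$, too. Then $f$ and $f^{-1}$ are orthogonally adjoint.
   Context: Let $(P,\le,0)$ be a poset with least element $0$. For $x,y\in P$, $x\perp y$ means $x\wedge y=0$, i.e. the infimum of $x,y$ exists and equals $0$ (equivalently, $0$ is the only common lower bound of $x$ and $y$). A $\perp$-morphism of $\mathbf P$ is a mapping $f\colon P\to P$ such that $x\perp y$ implies $f(x)\perp f(y)$ for all $x,y\in P$. Mappings $f,g\colon P\to P$ are orthogonally adjoint if for all $x,y\in P$: $f(x)\perp y$ if and only if $x\perp g(y)$. *)

theory Defs
  imports Main "HOL-Library.Lub_Glb"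
begin

definition orth :: "'a::order_bot \<Rightarrow> 'a \<Rightarrow> bool"
  where "orth x y \<longleftrightarrow> isGlb UNIV {x, y} bot"

lemma orth_iff: "orth x y \<longleftrightarrow> (\<forall>z. z \<le> x \<and> z \<le> y \<longrightarrow> z = bot)"
  by (auto simp: orth_def isGlb_def isLb_def greatestP_def setge_def setle_def bot_unique)

definition orth_morphism :: "('a::order_bot \<Rightarrow> 'a) \<Rightarrow> bool"
  where "orth_morphism f \<longleftrightarrow> (\<forall>x y. orth x y \<longrightarrow> orth (f x) (f y))"

definition orth_adjoint :: "('a::order_bot \<Rightarrow> 'a) \<Rightarrow> ('a \<Rightarrow> 'a) \<Rightarrow> bool"
  where "orth_adjoint f g \<longleftrightarrow> (\<forall>x y. orth (f x) y \<longleftrightarrow> orth x (g y))"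

end

theory Submission
  imports Defs
begin

text \<open>A map preserving orthogonality may be applied to both arguments at once:
  \<open>inv f\<close> sends the pair \<open>f x\<close>, \<open>y\<close> to \<open>x\<close>,
  \<open>inv f y\<close>, and \<open>f\<close> sends it back. So each direction of the adjointness
  is one morphism property followed by cancelling \<open>f\<close> against
  \<open>inv f\<close>.\<close>

theorem lemma22:
  fixes f :: "'a::order_bot \<Rightarrow> 'a"
  assumes "bij f"
    and "orth_morphism f"
    and "orth_morphism (inv f)"
  shows "orth_adjoint f (inv f)"
  unfolding orth_adjoint_def
proof (intro allI iffI)
  fix x y
  assume "orth (f x) y"
  then have "orth (inv f (f x)) (inv f y)"
    using assms(3) by (simp add: orth_morphism_def)
  then show "orth x (inv f y)"
    \<comment> \<open>Cancelling \<open>inv f\<close> after \<open>f\<close> rests on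
      injectivity.\<close>
    using \<open>bij f\<close> by (simp add: bij_is_inj)
next
  fix x y
  assume "orth x (inv f y)"
  then have "orth (f x) (f (inv f y))"
    using assms(2) by (simp add: orth_morphism_def)
  then show "orth (f x) y"
    \<comment> \<open>Here \<open>f\<close> comes after \<open>inv f\<close>, so the cancellation
      rests on surjectivity.\<close>
    using \<open>bij f\<close> by (simp add: bij_is_surj surj_f_inv_f)
qed

end
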